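(* For all $\mathrm{LE}$-models $\mathfrak{M}_1$ and $\mathfrak{M}_2$ with underlying polarities $(A_1,X_1,I_1)$, $(A_2,X_2,I_2)$, and all $a_1\in A_1$, $x_1\in X_1$, $a_2\in A_2$, $x_2\in X_2$: (1) $\mathfrak{M}_1,a_1\leftrightsquigarrow_A\mathfrak{M}_2,a_2$ if and only if $\mathfrak{M}_1^{\mathsf{FI}},\mathsf{Fi}(\mathbf{a_1})\rightleftarrows\mathfrak{M}_2^{\mathsf{FI}},\mathsf{Fi}(\mathbf{a_2})$. (2) $\mathfrak{M}_1,x_1\leftrightsquigarrow_X\mathfrak{M}_2,x_2$ if and only if $\mathfrak{M}_1^{\mathsf{FI}},\mathsf{Id}(\mathbf{x_1})\rightleftarrows\mathfrak{M}_2^{\mathsf{FI}},\mathsf{Id}(\mathbf{x_2})$.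
   Context: Language. Fix a countable set $\mathcal{V}$ of propositional variables. The set $\mathcal{L}$ of formulas is given by $\varphi ::= p\mid\bot\mid\top\mid\varphi\wedge\varphi\mid\varphi\vee\varphi\mid\Box\varphi\mid\Diamond\varphi$, $p\in\mathcal{V}$. Polarities. A polarity is $\mathfrak{P}=(A,X,I)$ with $A,X$ sets and $I\subseteq A\times X$. For $B\subseteq A$, $Y\subseteq X$: $B^\uparrow=\{x\in X\mid \forall b\in B,\ bIx\}$, $Y^\downarrow=\{a\in A\mid\forall y\in Y,\ aIy\}$. $B$ (resp. $Y$) is Galois-stable if $B^{\uparrow\downarrow}=B$ (resp. $Y^{\downarrow\uparrow}=Y$). A formal concept is a pair $c=([\![c]\!],(\![c]\!))$ with $[\![c]\!]\subseteq A$, $(\![c]\!)\subseteq X$, $[\![c]\!]^\uparrow=(\![c]\!)$, $(\![c]\!)^\downarrow=[\![c]\!]$. The formal concepts, ordered by $c\le d$ iff $[\![c]\!]\subseteq[\![d]\!]$, form a complete lattice $\mathfrak{P}^+$. $\mathrm{LE}$-models. An $\mathrm{LE}$-frame is $\mathfrak{F}=(A,X,I,R_\Box,R_\Diamond)$ where $(A,X,I)$ is a polarity and $R_\Box\subseteq A\times X$, $R_\Diamond\subseteq X\times A$ are $I$-compatible: for all $a\in A$, $x\in X$, the sets $\{a'\mid a'R_\Box x\}$, $\{x'\mid aR_\Box x'\}$, $\{x'\mid x'R_\Diamond a\}$, $\{a'\mid xR_\Diamond a'\}$ are Galois-stable. An $\mathrm{LE}$-model $\mathfrak{M}=(\mathfrak{F},V)$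 is an $\mathrm{LE}$-frame with a valuation $V$ assigning to each $p\in\mathcal{V}$ a formal concept $V(p)=([\![V(p)]\!],(\![V(p)]\!))$ of $(A,X,I)$. Satisfaction (for $a\in A$, $x\in X$): $a\Vdash p$ iff $a\in[\![V(p)]\!]$; $x\succ p$ iff $x\in(\![V(p)]\!)$; $a\Vdash\top$ always; $x\succ\top$ iff $\forall a\in A\, (aIx)$; $x\succ\bot$ always; $a\Vdash\bot$ iff $\forall x\in X\,(aIx)$; $a\Vdash\varphi\wedge\psi$ iff $a\Vdash\varphi$ and $a\Vdash\psi$; $x\succ\varphi\vee\psi$ iff $x\succ\varphi$ and $x\succ\psi$; $a\Vdash\Box\varphi$ iff $\forall x\in X\,(x\succ\varphi\Rightarrow aR_\Box x)$; $x\succ\Diamond\varphi$ iff $\forall a\in A\,(a\Vdash\varphi\Rightarrow xR_\Diamond a)$; for $\chi$ of the form $\varphi\wedge\psi$ or $\Box\varphi$: $x\succ\chi$ iff $\forall a\in A\,(a\Vdash\chi\Rightarrow aIx)$; for $\chi$ of the form $\varphi\vee\psi$ or $\Diamond\varphi$: $a\Vdash\chi$ iff $\forall x\in X\,(x\succ\chi\Rightarrow aIx)$. One writes $\mathfrak{M},a\Vdash\varphi$ and $\mathfrak{M},x\succ\varphi$. Modal equivalence. $\mathfrak{M}_1,a_1\leftrightsquigarrow_A\mathfrak{M}_2,a_2$ means: for all $\varphi\in\mathcal{L}$, $\mathfrak{M}_1,a_1\Vdash\varphi$ iff $\mathfrak{M}_2,a_2\Vdash\varphi$. $\mathfrak{M}_1,x_1\leftrightsquigarrow_X\mathfrak{M}_2,x_2$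 means: for all $\varphi\in\mathcal{L}$, $\mathfrak{M}_1,x_1\succ\varphi$ iff $\mathfrak{M}_2,x_2\succ\varphi$. Simulations. Superscript $c$ denotes the complement of a relation. A simulation from $\mathfrak{M}_1=(A_1,X_1,I_1,R_{\Box_1},R_{\Diamond_1},V_1)$ to $\mathfrak{M}_2=(A_2,X_2,I_2,R_{\Box_2},R_{\Diamond_2},V_2)$ is a pair $(S,T)$, $S\subseteq A_1\times A_2$, $T\subseteq X_1\times X_2$, such that for all $a_1,x_1,a_2,x_2$: 1. if $a_1Sa_2$ then for all $p\in\mathcal{V}$, $a_1\in[\![V_1(p)]\!]$ implies $a_2\in[\![V_2(p)]\!]$; 2. if $x_1Tx_2$ then for all $p\in\mathcal{V}$, $x_2\in(\![V_2(p)]\!)$ implies $x_1\in(\![V_1(p)]\!)$; 3. if $a_1Sa_2$ and $a_2I_2^cx_2$, there is $x_1\in X_1$ with $a_1I_1^cx_1$ and $x_1Tx_2$; 4. if $x_1Tx_2$ and $a_1I_1^cx_1$, there is $a_2\in A_2$ with $a_2I_2^cx_2$ and $a_1Sa_2$; 5. if $a_1Sa_2$ and $a_2R_{\Box_2}^cx_2$, there is $x_1\in X_1$ with $a_1R_{\Box_1}^cx_1$ and $x_1Tx_2$; 6. if $x_1Tx_2$ and $x_1R_{\Diamond_1}^ca_1$, there is $a_2\in A_2$ with $x_2R_{\Diamond_2}^ca_2$ and $a_1Sa_2$. Bisimilarity. $\mathfrak{M}_1,a_1\rightleftarrows\mathfrak{M}_2,a_2$ means: there is a simulation $(S,T)$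 from $\mathfrak{M}_1$ to $\mathfrak{M}_2$ with $a_1Sa_2$ and a simulation $(S',T')$ from $\mathfrak{M}_2$ to $\mathfrak{M}_1$ with $a_2S'a_1$. $\mathfrak{M}_1,x_1\rightleftarrows\mathfrak{M}_2,x_2$ means: there is a simulation $(S,T)$ from $\mathfrak{M}_1$ to $\mathfrak{M}_2$ with $x_1Tx_2$ and a simulation $(S',T')$ from $\mathfrak{M}_2$ to $\mathfrak{M}_1$ with $x_2T'x_1$. Filter-ideal extension. The complex algebra of $\mathfrak{F}$ is $\mathfrak{F}^+$, the lattice $\mathfrak{P}^+$ with operators $\Box c=(B,B^\uparrow)$, $B=\{a\in A\mid\forall x\in(\![c]\!),\ aR_\Box x\}$, and $\Diamond c=(Y^\downarrow,Y)$, $Y=\{x\in X\mid\forall a\in[\![c]\!],\ xR_\Diamond a\}$. Filters (ideals) of $\mathfrak{F}^+$ are nonempty up-sets closed under binary meets (nonempty down-sets closed under binary joins); the whole lattice is allowed. The filter-ideal extension of $\mathfrak{M}=(\mathfrak{F},V)$ is the $\mathrm{LE}$-model $\mathfrak{M}^{\mathsf{FI}}$ whose first sort is the set of all filters of $\mathfrak{F}^+$, whose second sort is the set of all ideals of $\mathfrak{F}^+$, with, for $F$ a filter and $J$ an ideal: $F\,I\,J$ iff $F\cap J\ne\emptyset$; $F\,R_\Box\,J$ iff there is $c\in J$ with $\Box c\in F$; $J\,R_\Diamond\,F$ iff there is $c\in F$ with $\Diamond c\in J$; and $V^{\mathsf{FI}}(p)=(\{F\mid V(p)\in F\},\{J\mid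 V(p)\in J\})$. For $a\in A$, $\mathbf{a}=(\{a\}^{\uparrow\downarrow},\{a\}^\uparrow)$, and $\mathsf{Fi}(\mathbf{a})$ is the principal filter of $\mathfrak{F}^+$ generated by $\mathbf{a}$; for $x\in X$, $\mathbf{x}=(\{x\}^\downarrow,\{x\}^{\downarrow\uparrow})$, and $\mathsf{Id}(\mathbf{x})$ is the principal ideal generated by $\mathbf{x}$. *)

theory Defs
  imports "HOL-Algebra.Complete_Lattice" "HOL-Library.Countable"
begin

datatype 'v fm =
    Var 'v | Bot | Top
  | Conj "'v fm" "'v fm" | Disj "'v fm" "'v fm"
  | Box "'v fm" | Dia "'v fm"

text \<open>In a polarity \<open>(A, X, I)\<close>, \<open>A\<close> is the set \<open>Obj\<close> of objects, \<open>X\<close> the set \<open>Feat\<close> of features and \<open>I\<close> the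
  incidence relation \<open>Inc\<close>. A concept is the pair of its extension and its intension.\<close>

type_synonym ('a, 'x) concept = "'a set \<times> 'x set"

record ('a, 'x) polarity =
  Obj :: "'a set"
  Feat :: "'x set"
  Inc :: "('a \<times> 'x) set"

definition polarity :: "('a, 'x, 'm) polarity_scheme \<Rightarrow> bool" where
  "polarity P \<longleftrightarrow> Inc P \<subseteq> Obj P \<times> Feat P"

definition up :: "('a, 'x, 'm) polarity_scheme \<Rightarrow> 'a set \<Rightarrow> 'x set" where
  "up P B = {x \<in> Feat P. \<forall>b\<in>B. (b, x) \<in> Inc P}"

definition down :: "('a, 'x, 'm) polarity_scheme \<Rightarrow> 'x set \<Rightarrow> 'a set" where
  "down P Y = {a \<in> Obj P. \<forall>y\<in>Y. (a, y) \<in> Inc P}"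

definition stable_Obj :: "('a, 'x, 'm) polarity_scheme \<Rightarrow> 'a set \<Rightarrow> bool" where
  "stable_Obj P B \<longleftrightarrow> B \<subseteq> Obj P \<and> down P (up P B) = B"

definition stable_Feat :: "('a, 'x, 'm) polarity_scheme \<Rightarrow> 'x set \<Rightarrow> bool" where
  "stable_Feat P Y \<longleftrightarrow> Y \<subseteq> Feat P \<and> up P (down P Y) = Y"

definition concepts :: "('a, 'x, 'm) polarity_scheme \<Rightarrow> ('a, 'x) concept set" where
  "concepts P = {(B, Y). B \<subseteq> Obj P \<and> Y \<subseteq> Feat P \<and> up P B = Y \<and> down P Y = B}"

definition concept_lattice :: "('a, 'x, 'm) polarity_scheme \<Rightarrow> ('a, 'x) concept gorder" where
  "concept_lattice P =
     \<lparr>carrier = concepts P, eq = (=), le = (\<lambda>c d. fst c \<subseteq> fst d)\<rparr>"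

definition obj_concept :: "('a, 'x, 'm) polarity_scheme \<Rightarrow> 'a \<Rightarrow> ('a, 'x) concept" where
  "obj_concept P a = (down P (up P {a}), up P {a})"

definition feat_concept :: "('a, 'x, 'm) polarity_scheme \<Rightarrow> 'x \<Rightarrow> ('a, 'x) concept" where
  "feat_concept P x = (down P {x}, up P (down P {x}))"

record ('a, 'x) frame = "('a, 'x) polarity" +
  RBox :: "('a \<times> 'x) set"
  RDia :: "('x \<times> 'a) set"

definition le_frame :: "('a, 'x, 'm) frame_scheme \<Rightarrow> bool" where
  "le_frame F \<longleftrightarrow>
     polarity F \<and> RBox F \<subseteq> Obj F \<times> Feat F \<and> RDia F \<subseteq> Feat F \<times> Obj F \<and>
     (\<forall>x\<in>Feat F. stable_Obj F {a. (a, x) \<in> RBox F}) \<and>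
     (\<forall>a\<in>Obj F. stable_Feat F {x. (a, x) \<in> RBox F}) \<and>
     (\<forall>a\<in>Obj F. stable_Feat F {x. (x, a) \<in> RDia F}) \<and>
     (\<forall>x\<in>Feat F. stable_Obj F {a. (x, a) \<in> RDia F})"

record ('a, 'x, 'v) model = "('a, 'x) frame" +
  Val :: "'v \<Rightarrow> ('a, 'x) concept"

definition le_model :: "('a, 'x, 'v, 'm) model_scheme \<Rightarrow> bool" where
  "le_model M \<longleftrightarrow> le_frame M \<and> (\<forall>p. Val M p \<in> concepts M)"

text \<open>\<open>sat M a \<phi>\<close> is \<open>M, a \<tturnstile> \<phi>\<close> and \<open>cosat M x \<phi>\<close> is \<open>M, x \<succ> \<phi>\<close>; they are
  only meaningful for \<open>a \<in> Obj M\<close> and \<open>x \<in> Feat M\<close>.\<close>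

function (sequential)
  sat :: "('a, 'x, 'v, 'm) model_scheme \<Rightarrow> 'a \<Rightarrow> 'v fm \<Rightarrow> bool" and
  cosat :: "('a, 'x, 'v, 'm) model_scheme \<Rightarrow> 'x \<Rightarrow> 'v fm \<Rightarrow> bool" where
  "sat M a (Var p) \<longleftrightarrow> a \<in> fst (Val M p)"
| "sat M a Top \<longleftrightarrow> True"
| "sat M a Bot \<longleftrightarrow> (\<forall>x\<in>Feat M. (a, x) \<in> Inc M)"
| "sat M a (Conj \<phi> \<psi>) \<longleftrightarrow> sat M a \<phi> \<and> sat M a \<psi>"
| "sat M a (Disj \<phi> \<psi>) \<longleftrightarrow> (\<forall>x\<in>Feat M. cosat M x (Disj \<phi> \<psi>) \<longrightarrow> (a, x) \<in> Inc M)"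
| "sat M a (Box \<phi>) \<longleftrightarrow> (\<forall>x\<in>Feat M. cosat M x \<phi> \<longrightarrow> (a, x) \<in> RBox M)"
| "sat M a (Dia \<phi>) \<longleftrightarrow> (\<forall>x\<in>Feat M. cosat M x (Dia \<phi>) \<longrightarrow> (a, x) \<in> Inc M)"
| "cosat M x (Var p) \<longleftrightarrow> x \<in> snd (Val M p)"
| "cosat M x Top \<longleftrightarrow> (\<forall>a\<in>Obj M. (a, x) \<in> Inc M)"
| "cosat M x Bot \<longleftrightarrow> True"
| "cosat M x (Conj \<phi> \<psi>) \<longleftrightarrow> (\<forall>a\<in>Obj M. sat M a (Conj \<phi> \<psi>) \<longrightarrow> (a, x) \<in> Inc M)"
| "cosat M x (Disj \<phi> \<psi>) \<longleftrightarrow> cosat M x \<phi> \<and> cosat M x \<psi>"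
| "cosat M x (Box \<phi>) \<longleftrightarrow> (\<forall>a\<in>Obj M. sat M a (Box \<phi>) \<longrightarrow> (a, x) \<in> Inc M)"
| "cosat M x (Dia \<phi>) \<longleftrightarrow> (\<forall>a\<in>Obj M. sat M a \<phi> \<longrightarrow> (x, a) \<in> RDia M)"
  by pat_completeness auto

text \<open>The measure makes \<open>sat\<close> on \<open>Disj\<close>, \<open>Dia\<close> larger than \<open>cosat\<close> on the same formula,
  and dually for \<open>Conj\<close>, \<open>Box\<close>.\<close>

termination
  by (relation "measure (\<lambda>s. case s of
        Inl (M, a, \<phi>) \<Rightarrow> 2 * size \<phi> + (case \<phi> of Disj _ _ \<Rightarrow> 1 | Dia _ \<Rightarrow> 1 | _ \<Rightarrow> 0)
      | Inr (M, x, \<phi>) \<Rightarrow> 2 * size \<phi> + (case \<phi> of Conj _ _ \<Rightarrow> 1 | Box _ \<Rightarrow> 1 | _ \<Rightarrow> 0))")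
    (auto split: fm.splits)

definition modal_equiv_Obj ::
  "('a, 'x, 'v, 'm) model_scheme \<Rightarrow> 'a \<Rightarrow> ('b, 'y, 'v, 'n) model_scheme \<Rightarrow> 'b \<Rightarrow> bool" where
  "modal_equiv_Obj M1 a1 M2 a2 \<longleftrightarrow> (\<forall>\<phi>. sat M1 a1 \<phi> \<longleftrightarrow> sat M2 a2 \<phi>)"

definition modal_equiv_Feat ::
  "('a, 'x, 'v, 'm) model_scheme \<Rightarrow> 'x \<Rightarrow> ('b, 'y, 'v, 'n) model_scheme \<Rightarrow> 'y \<Rightarrow> bool" where
  "modal_equiv_Feat M1 x1 M2 x2 \<longleftrightarrow> (\<forall>\<phi>. cosat M1 x1 \<phi> \<longleftrightarrow> cosat M2 x2 \<phi>)"

definition simulation ::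
  "('a, 'x, 'v, 'm) model_scheme \<Rightarrow> ('b, 'y, 'v, 'n) model_scheme \<Rightarrow>
   ('a \<times> 'b) set \<Rightarrow> ('x \<times> 'y) set \<Rightarrow> bool" where
  "simulation M1 M2 S T \<longleftrightarrow>
     S \<subseteq> Obj M1 \<times> Obj M2 \<and> T \<subseteq> Feat M1 \<times> Feat M2 \<and>
     (\<forall>a1 a2. (a1, a2) \<in> S \<longrightarrow> (\<forall>p. a1 \<in> fst (Val M1 p) \<longrightarrow> a2 \<in> fst (Val M2 p))) \<and>
     (\<forall>x1 x2. (x1, x2) \<in> T \<longrightarrow> (\<forall>p. x2 \<in> snd (Val M2 p) \<longrightarrow> x1 \<in> snd (Val M1 p))) \<and>
     (\<forall>a1 a2. \<forall>x2\<in>Feat M2. (a1, a2) \<in> S \<and> (a2, x2) \<notin> Inc M2 \<longrightarrow>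
        (\<exists>x1\<in>Feat M1. (a1, x1) \<notin> Inc M1 \<and> (x1, x2) \<in> T)) \<and>
     (\<forall>x1 x2. \<forall>a1\<in>Obj M1. (x1, x2) \<in> T \<and> (a1, x1) \<notin> Inc M1 \<longrightarrow>
        (\<exists>a2\<in>Obj M2. (a2, x2) \<notin> Inc M2 \<and> (a1, a2) \<in> S)) \<and>
     (\<forall>a1 a2. \<forall>x2\<in>Feat M2. (a1, a2) \<in> S \<and> (a2, x2) \<notin> RBox M2 \<longrightarrow>
        (\<exists>x1\<in>Feat M1. (a1, x1) \<notin> RBox M1 \<and> (x1, x2) \<in> T)) \<and>
     (\<forall>x1 x2. \<forall>a1\<in>Obj M1. (x1, x2) \<in> T \<and> (x1, a1) \<notin> RDia M1 \<longrightarrow>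
        (\<exists>a2\<in>Obj M2. (x2, a2) \<notin> RDia M2 \<and> (a1, a2) \<in> S))"

definition bisimilar_Obj ::
  "('a, 'x, 'v, 'm) model_scheme \<Rightarrow> 'a \<Rightarrow> ('b, 'y, 'v, 'n) model_scheme \<Rightarrow> 'b \<Rightarrow> bool" where
  "bisimilar_Obj M1 a1 M2 a2 \<longleftrightarrow>
     (\<exists>S T. simulation M1 M2 S T \<and> (a1, a2) \<in> S) \<and>
     (\<exists>S' T'. simulation M2 M1 S' T' \<and> (a2, a1) \<in> S')"

definition bisimilar_Feat ::
  "('a, 'x, 'v, 'm) model_scheme \<Rightarrow> 'x \<Rightarrow> ('b, 'y, 'v, 'n) model_scheme \<Rightarrow> 'y \<Rightarrow> bool" where
  "bisimilar_Feat M1 x1 M2 x2 \<longleftrightarrow>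
     (\<exists>S T. simulation M1 M2 S T \<and> (x1, x2) \<in> T) \<and>
     (\<exists>S' T'. simulation M2 M1 S' T' \<and> (x2, x1) \<in> T')"

definition box_op :: "('a, 'x, 'm) frame_scheme \<Rightarrow> ('a, 'x) concept \<Rightarrow> ('a, 'x) concept" where
  "box_op F c = (let B = {a \<in> Obj F. \<forall>x\<in>snd c. (a, x) \<in> RBox F} in (B, up F B))"

definition dia_op :: "('a, 'x, 'm) frame_scheme \<Rightarrow> ('a, 'x) concept \<Rightarrow> ('a, 'x) concept" where
  "dia_op F c = (let Y = {x \<in> Feat F. \<forall>a\<in>fst c. (x, a) \<in> RDia F} in (down F Y, Y))"

text \<open>Filters and ideals are nonempty but need not be proper.\<close>

definition lat_filters :: "('c, 'm) gorder_scheme \<Rightarrow> 'c set set" where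
  "lat_filters L = {F. F \<subseteq> carrier L \<and> F \<noteq> {} \<and>
     (\<forall>c\<in>F. \<forall>d\<in>carrier L. c \<sqsubseteq>\<^bsub>L\<^esub> d \<longrightarrow> d \<in> F) \<and>
     (\<forall>c\<in>F. \<forall>d\<in>F. c \<sqinter>\<^bsub>L\<^esub> d \<in> F)}"

definition lat_ideals :: "('c, 'm) gorder_scheme \<Rightarrow> 'c set set" where
  "lat_ideals L = {J. J \<subseteq> carrier L \<and> J \<noteq> {} \<and>
     (\<forall>c\<in>J. \<forall>d\<in>carrier L. d \<sqsubseteq>\<^bsub>L\<^esub> c \<longrightarrow> d \<in> J) \<and>
     (\<forall>c\<in>J. \<forall>d\<in>J. c \<squnion>\<^bsub>L\<^esub> d \<in> J)}"

definition principal_filter :: "('c, 'm) gorder_scheme \<Rightarrow> 'c \<Rightarrow> 'c set" where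
  "principal_filter L c = {d \<in> carrier L. c \<sqsubseteq>\<^bsub>L\<^esub> d}"

definition principal_ideal :: "('c, 'm) gorder_scheme \<Rightarrow> 'c \<Rightarrow> 'c set" where
  "principal_ideal L c = {d \<in> carrier L. d \<sqsubseteq>\<^bsub>L\<^esub> c}"

definition FI_ext ::
  "('a, 'x, 'v, 'm) model_scheme \<Rightarrow> (('a, 'x) concept set, ('a, 'x) concept set, 'v) model" where
  "FI_ext M =
     (let Fs = lat_filters (concept_lattice M); Js = lat_ideals (concept_lattice M) in
      \<lparr>Obj = Fs,
       Feat = Js,
       Inc = {(F, J) \<in> Fs \<times> Js. F \<inter> J \<noteq> {}},
       RBox = {(F, J) \<in> Fs \<times> Js. \<exists>c\<in>J. box_op M c \<in> F},
       RDia = {(J, F) \<in> Js \<times> Fs. \<exists>c\<in>F. dia_op M c \<in> J},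
       Val = (\<lambda>p. ({F \<in> Fs. Val M p \<in> F}, {J \<in> Js. Val M p \<in> J}))\<rparr>)"

definition Fi :: "('a, 'x, 'm) polarity_scheme \<Rightarrow> 'a \<Rightarrow> ('a, 'x) concept set" where
  "Fi P a = principal_filter (concept_lattice P) (obj_concept P a)"

definition Idl :: "('a, 'x, 'm) polarity_scheme \<Rightarrow> 'x \<Rightarrow> ('a, 'x) concept set" where
  "Idl P x = principal_ideal (concept_lattice P) (feat_concept P x)"

end

theory Submission
  imports Defs
begin

text \<open>
  In an LE-model \<open>M\<close> every formula \<open>\<phi>\<close> denotes a concept, its meaning, and the map from formulas to
  meanings is a homomorphism into the complex algebra. In the filter-ideal extension a filter
  satisfies \<open>\<phi>\<close> iff it contains the meaning of \<open>\<phi>\<close>, and dually for ideals. As the meaning of \<open>\<phi>\<close>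
  belongs to the principal filter of \<open>a\<close> iff \<open>a\<close> satisfies \<open>\<phi>\<close>, passing from \<open>a\<close> to \<open>Fi M a\<close> (and
  from \<open>x\<close> to \<open>Idl M x\<close>) changes no truth values (\<open>sat_Fi\<close>, \<open>cosat_Idl\<close>). It remains to compare modal
  equivalence and bisimilarity of points of two filter-ideal extensions.

  That bisimilar points are modally equivalent holds in arbitrary models: truth at objects travels
  forwards, and truth at features backwards, along a simulation (\<open>simulation_preserves\<close>).

  For the converse, filter-ideal extensions behave like saturated models: preservation of truth is
  itself a simulation (\<open>inclusion_simulation\<close>). Given filters \<open>F1\<close>, \<open>F2\<close> such that all formulas true
  at \<open>F1\<close> are true at \<open>F2\<close>, and an ideal \<open>J2\<close> not related to \<open>F2\<close> by \<open>Inc\<close> (or \<open>RBox\<close>), one needs an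
  ideal \<open>J1\<close> not related to \<open>F1\<close> at which all formulas true at \<open>J2\<close> are true. The ideal generated by
  the meanings of these formulas in the first model works for \<open>Inc\<close> and for \<open>RBox\<close>. Because formulas
  are closed under disjunction, a concept belongs to it iff it is below the meaning of a single
  formula true at \<open>J2\<close>. So if it were related to \<open>F1\<close>, then some such \<open>\<phi>\<close>, respectively \<open>Box \<phi>\<close>, would be true
  at \<open>F1\<close>, hence at \<open>F2\<close>, and \<open>F2\<close> would be related to \<open>J2\<close>. The clauses that ask for a filter are
  treated dually, by means of conjunctions.
\<close>

section \<open>The lattice of concepts\<close>

lemma up_antimono: "B \<subseteq> C \<Longrightarrow> up P C \<subseteq> up P B"
  by (auto simp: up_def)

lemma down_antimono: "Y \<subseteq> Z \<Longrightarrow> down P Z \<subseteq> down P Y"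
  by (auto simp: down_def)

lemma down_up_ext: "B \<subseteq> Obj P \<Longrightarrow> B \<subseteq> down P (up P B)"
  by (auto simp: up_def down_def)

lemma up_down_ext: "Y \<subseteq> Feat P \<Longrightarrow> Y \<subseteq> up P (down P Y)"
  by (auto simp: up_def down_def)

lemma conceptD:
  assumes "c \<in> concepts P"
  shows "fst c \<subseteq> Obj P" "snd c \<subseteq> Feat P" "up P (fst c) = snd c" "down P (snd c) = fst c"
  using assms by (auto simp: concepts_def)

lemma concept_eqI: "c \<in> concepts P \<Longrightarrow> d \<in> concepts P \<Longrightarrow> fst c = fst d \<Longrightarrow> c = d"
  by (metis conceptD(3) prod_eqI)

lemma concept_le_iff:
  "c \<in> concepts P \<Longrightarrow> d \<in> concepts P \<Longrightarrow> fst c \<subseteq> fst d \<longleftrightarrow> snd d \<subseteq> snd c"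
  by (metis conceptD(3,4) up_antimono down_antimono)

lemma extent_concept: "stable_Obj P B \<Longrightarrow> (B, up P B) \<in> concepts P"
  by (auto simp: stable_Obj_def concepts_def up_def)

lemma intent_concept: "stable_Feat P Y \<Longrightarrow> (down P Y, Y) \<in> concepts P"
  by (auto simp: stable_Feat_def concepts_def down_def)

lemma stable_Obj_down: "Y \<subseteq> Feat P \<Longrightarrow> stable_Obj P (down P Y)"
  unfolding stable_Obj_def
  by (metis (no_types, lifting) down_antimono down_def down_up_ext mem_Collect_eq subsetI
      subset_antisym up_down_ext)

lemma stable_Feat_up: "B \<subseteq> Obj P \<Longrightarrow> stable_Feat P (up P B)"
  unfolding stable_Feat_def
  by (metis (no_types, lifting) up_antimono up_def down_up_ext mem_Collect_eq subsetI
      subset_antisym up_down_ext)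

text \<open>A modal operator yields the set of points related to all elements of a given set, that is, an
  intersection of sections of the accessibility relation; hence stability of the sections is enough
  for the complex algebra to be closed under the operators.\<close>

lemma stable_Obj_Inter:
  assumes "\<And>i. i \<in> K \<Longrightarrow> stable_Obj P (B i)"
  shows "stable_Obj P {a \<in> Obj P. \<forall>i\<in>K. a \<in> B i}" (is "stable_Obj P ?C")
proof -
  have "down P (up P ?C) \<subseteq> B i" if "i \<in> K" for i
  proof -
    have "down P (up P ?C) \<subseteq> down P (up P (B i))"
      using that by (intro down_antimono up_antimono) auto
    then show ?thesis using assms[OF that] by (simp add: stable_Obj_def)
  qed
  moreover have "down P (up P ?C) \<subseteq> Obj P" by (auto simp: down_def)
  moreover have "?C \<subseteq> down P (up P ?C)" by (rule down_up_ext) auto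
  ultimately show ?thesis unfolding stable_Obj_def by blast
qed

lemma stable_Feat_Inter:
  assumes "\<And>i. i \<in> K \<Longrightarrow> stable_Feat P (Y i)"
  shows "stable_Feat P {x \<in> Feat P. \<forall>i\<in>K. x \<in> Y i}" (is "stable_Feat P ?Z")
proof -
  have "up P (down P ?Z) \<subseteq> Y i" if "i \<in> K" for i
  proof -
    have "up P (down P ?Z) \<subseteq> up P (down P (Y i))"
      using that by (intro down_antimono up_antimono) auto
    then show ?thesis using assms[OF that] by (simp add: stable_Feat_def)
  qed
  moreover have "up P (down P ?Z) \<subseteq> Feat P" by (auto simp: up_def)
  moreover have "?Z \<subseteq> up P (down P ?Z)" by (rule up_down_ext) auto
  ultimately show ?thesis unfolding stable_Feat_def by blast
qed

definition concept_meet ::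
  "('a, 'x, 'm) polarity_scheme \<Rightarrow> ('a, 'x) concept \<Rightarrow> ('a, 'x) concept \<Rightarrow> ('a, 'x) concept" where
  "concept_meet P c d = (fst c \<inter> fst d, up P (fst c \<inter> fst d))"

definition concept_join ::
  "('a, 'x, 'm) polarity_scheme \<Rightarrow> ('a, 'x) concept \<Rightarrow> ('a, 'x) concept \<Rightarrow> ('a, 'x) concept" where
  "concept_join P c d = (down P (snd c \<inter> snd d), snd c \<inter> snd d)"

lemma concept_meet_closed:
  assumes "c \<in> concepts P" "d \<in> concepts P"
  shows "concept_meet P c d \<in> concepts P"
proof -
  have "fst c \<inter> fst d = down P (snd c \<union> snd d)"
    using assms[THEN conceptD(4)] by (auto simp: down_def)
  then have "stable_Obj P (fst c \<inter> fst d)"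
    using assms[THEN conceptD(2)] by (simp add: stable_Obj_down)
  then show ?thesis unfolding concept_meet_def by (rule extent_concept)
qed

lemma concept_join_closed:
  assumes "c \<in> concepts P" "d \<in> concepts P"
  shows "concept_join P c d \<in> concepts P"
proof -
  have "snd c \<inter> snd d = up P (fst c \<union> fst d)"
    using assms[THEN conceptD(3)] by (auto simp: up_def)
  then have "stable_Feat P (snd c \<inter> snd d)"
    using assms[THEN conceptD(1)] by (simp add: stable_Feat_up)
  then show ?thesis unfolding concept_join_def by (rule intent_concept)
qed

lemma carrier_concept_lattice [simp]: "carrier (concept_lattice P) = concepts P"
  by (simp add: concept_lattice_def)

lemma le_concept_lattice [simp]: "c \<sqsubseteq>\<^bsub>concept_lattice P\<^esub> d \<longleftrightarrow> fst c \<subseteq> fst d"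
  by (simp add: concept_lattice_def)

lemma meet_concept_lattice:
  assumes cd: "c \<in> concepts P" "d \<in> concepts P"
  shows "c \<sqinter>\<^bsub>concept_lattice P\<^esub> d = concept_meet P c d"
proof -
  let ?L = "concept_lattice P"
  have lower: "Lower ?L {c, d} = {y \<in> concepts P. fst y \<subseteq> fst c \<and> fst y \<subseteq> fst d}"
    using cd by (auto simp: Lower_def simp del: split_paired_All)
  have "greatest ?L z (Lower ?L {c, d}) \<longleftrightarrow> z = concept_meet P c d" for z
  proof
    assume "greatest ?L z (Lower ?L {c, d})"
    then have z: "z \<in> concepts P" "fst z \<subseteq> fst c" "fst z \<subseteq> fst d"
      and max: "\<And>y. y \<in> concepts P \<Longrightarrow> fst y \<subseteq> fst c \<Longrightarrow> fst y \<subseteq> fst d \<Longrightarrow> fst y \<subseteq> fst z"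
      unfolding greatest_def lower le_concept_lattice by blast+
    have "fst z = fst (concept_meet P c d)"
      using z max[OF concept_meet_closed[OF cd]] by (auto simp: concept_meet_def)
    then show "z = concept_meet P c d"
      by (rule concept_eqI[OF z(1) concept_meet_closed[OF cd]])
  next
    assume "z = concept_meet P c d"
    then show "greatest ?L z (Lower ?L {c, d})"
      using concept_meet_closed[OF cd]
      by (auto simp: greatest_def lower) (auto simp: concept_meet_def)
  qed
  then show ?thesis by (simp add: meet_def inf_def)
qed

lemma join_concept_lattice:
  assumes cd: "c \<in> concepts P" "d \<in> concepts P"
  shows "c \<squnion>\<^bsub>concept_lattice P\<^esub> d = concept_join P c d"
proof -
  let ?L = "concept_lattice P" and ?j = "concept_join P c d"
  have above: "fst c \<subseteq> fst ?j" "fst d \<subseteq> fst ?j"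
    using cd concept_join_closed[OF cd] by (simp_all add: concept_le_iff) (simp_all add: concept_join_def)
  have below: "fst ?j \<subseteq> fst y"
    if "y \<in> concepts P" "fst c \<subseteq> fst y" "fst d \<subseteq> fst y" for y
    using that cd concept_join_closed[OF cd]
    by (simp add: concept_le_iff) (simp add: concept_join_def)
  have upper: "Upper ?L {c, d} = {y \<in> concepts P. fst c \<subseteq> fst y \<and> fst d \<subseteq> fst y}"
    using cd by (auto simp: Upper_def simp del: split_paired_All)
  have "least ?L z (Upper ?L {c, d}) \<longleftrightarrow> z = ?j" for z
  proof
    assume "least ?L z (Upper ?L {c, d})"
    then have z: "z \<in> concepts P" "fst c \<subseteq> fst z" "fst d \<subseteq> fst z"
      and min: "\<And>y. y \<in> concepts P \<Longrightarrow> fst c \<subseteq> fst y \<Longrightarrow> fst d \<subseteq> fst y \<Longrightarrow> fst z \<subseteq> fst y"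
      unfolding least_def upper le_concept_lattice by blast+
    have "fst z = fst ?j"
      using below[OF z] min[OF concept_join_closed[OF cd] above] by auto
    then show "z = ?j"
      by (rule concept_eqI[OF z(1) concept_join_closed[OF cd]])
  next
    assume "z = ?j"
    then show "least ?L z (Upper ?L {c, d})"
      using concept_join_closed[OF cd] above below by (simp add: least_def upper)
  qed
  then show ?thesis by (simp add: join_def sup_def)
qed

abbreviation filters :: "('a, 'x, 'm) polarity_scheme \<Rightarrow> ('a, 'x) concept set set" where
  "filters P \<equiv> lat_filters (concept_lattice P)"

abbreviation ideals :: "('a, 'x, 'm) polarity_scheme \<Rightarrow> ('a, 'x) concept set set" where
  "ideals P \<equiv> lat_ideals (concept_lattice P)"

lemma filters_iff:
  "F \<in> filters P \<longleftrightarrow> F \<subseteq> concepts P \<and> F \<noteq> {} \<and>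
     (\<forall>c\<in>F. \<forall>d\<in>concepts P. fst c \<subseteq> fst d \<longrightarrow> d \<in> F) \<and>
     (\<forall>c\<in>F. \<forall>d\<in>F. concept_meet P c d \<in> F)"
  unfolding lat_filters_def mem_Collect_eq carrier_concept_lattice le_concept_lattice
  by (intro conj_cong refl ball_cong) (metis meet_concept_lattice subsetD)

lemma ideals_iff:
  "J \<in> ideals P \<longleftrightarrow> J \<subseteq> concepts P \<and> J \<noteq> {} \<and>
     (\<forall>c\<in>J. \<forall>d\<in>concepts P. fst d \<subseteq> fst c \<longrightarrow> d \<in> J) \<and>
     (\<forall>c\<in>J. \<forall>d\<in>J. concept_join P c d \<in> J)"
  unfolding lat_ideals_def mem_Collect_eq carrier_concept_lattice le_concept_lattice
  by (intro conj_cong refl ball_cong) (metis join_concept_lattice subsetD)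

lemma filter_mono:
  "F \<in> filters P \<Longrightarrow> c \<in> F \<Longrightarrow> d \<in> concepts P \<Longrightarrow> fst c \<subseteq> fst d \<Longrightarrow> d \<in> F"
  unfolding filters_iff by blast

lemma ideal_mono:
  "J \<in> ideals P \<Longrightarrow> c \<in> J \<Longrightarrow> d \<in> concepts P \<Longrightarrow> fst d \<subseteq> fst c \<Longrightarrow> d \<in> J"
  unfolding ideals_iff by blast

lemma filter_meet_iff:
  assumes "F \<in> filters P" "c \<in> concepts P" "d \<in> concepts P"
  shows "concept_meet P c d \<in> F \<longleftrightarrow> c \<in> F \<and> d \<in> F"
proof -
  have "fst (concept_meet P c d) \<subseteq> fst c" "fst (concept_meet P c d) \<subseteq> fst d"
    by (simp_all add: concept_meet_def)
  then show ?thesis using assms unfolding filters_iff by blast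
qed

lemma ideal_join_iff:
  assumes "J \<in> ideals P" "c \<in> concepts P" "d \<in> concepts P"
  shows "concept_join P c d \<in> J \<longleftrightarrow> c \<in> J \<and> d \<in> J"
proof -
  have "fst c \<subseteq> fst (concept_join P c d)" "fst d \<subseteq> fst (concept_join P c d)"
    using assms(2,3) concept_join_closed[OF assms(2,3)]
    by (simp_all add: concept_le_iff) (simp_all add: concept_join_def)
  then show ?thesis using assms unfolding ideals_iff by blast
qed

lemma concept_meet_mono:
  "fst c \<subseteq> fst c' \<Longrightarrow> fst d \<subseteq> fst d' \<Longrightarrow> fst (concept_meet P c d) \<subseteq> fst (concept_meet P c' d')"
  by (auto simp: concept_meet_def)

lemma concept_join_mono:
  assumes "c \<in> concepts P" "d \<in> concepts P" "c' \<in> concepts P" "d' \<in> concepts P"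
    and "fst c \<subseteq> fst c'" "fst d \<subseteq> fst d'"
  shows "fst (concept_join P c d) \<subseteq> fst (concept_join P c' d')"
proof -
  have "snd c' \<inter> snd d' \<subseteq> snd c \<inter> snd d"
    using assms by (auto simp: concept_le_iff)
  then show ?thesis by (simp add: concept_join_def down_antimono)
qed

lemma principal_filter_filter:
  assumes "c \<in> concepts P"
  shows "principal_filter (concept_lattice P) c \<in> filters P"
proof -
  have "fst c \<subseteq> fst (concept_meet P d e)" if "fst c \<subseteq> fst d" "fst c \<subseteq> fst e" for d e
    using that by (simp add: concept_meet_def)
  then show ?thesis
    using assms concept_meet_closed
    unfolding filters_iff principal_filter_def carrier_concept_lattice le_concept_lattice by blast
qed

lemma principal_ideal_ideal:
  assumes "c \<in> concepts P"
  shows "principal_ideal (concept_lattice P) c \<in> ideals P"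
proof -
  have "fst (concept_join P d e) \<subseteq> fst c"
    if "d \<in> concepts P" "e \<in> concepts P" "fst d \<subseteq> fst c" "fst e \<subseteq> fst c" for d e
    using that assms concept_join_closed[OF that(1,2)]
    by (simp add: concept_le_iff) (simp add: concept_join_def)
  then show ?thesis
    using assms concept_join_closed
    unfolding ideals_iff principal_ideal_def carrier_concept_lattice le_concept_lattice by blast
qed

section \<open>Formulas as elements of the complex algebra\<close>

definition meaning :: "('a, 'x, 'v, 'm) model_scheme \<Rightarrow> 'v fm \<Rightarrow> ('a, 'x) concept" where
  "meaning M \<phi> = ({a \<in> Obj M. sat M a \<phi>}, {x \<in> Feat M. cosat M x \<phi>})"

lemma box_op_closed:
  assumes "le_frame F" "c \<in> concepts F"
  shows "box_op F c \<in> concepts F"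
proof -
  have "stable_Obj F {a \<in> Obj F. \<forall>x\<in>snd c. a \<in> {a. (a, x) \<in> RBox F}}"
    using assms conceptD(2)[OF assms(2)] by (intro stable_Obj_Inter) (auto simp: le_frame_def)
  then show ?thesis by (simp add: box_op_def Let_def extent_concept)
qed

lemma dia_op_closed:
  assumes "le_frame F" "c \<in> concepts F"
  shows "dia_op F c \<in> concepts F"
proof -
  have "stable_Feat F {x \<in> Feat F. \<forall>a\<in>fst c. x \<in> {x. (x, a) \<in> RDia F}}"
    using assms conceptD(1)[OF assms(2)] by (intro stable_Feat_Inter) (auto simp: le_frame_def)
  then show ?thesis by (simp add: dia_op_def Let_def intent_concept)
qed

lemma box_op_mono:
  "c \<in> concepts F \<Longrightarrow> d \<in> concepts F \<Longrightarrow> fst c \<subseteq> fst d \<Longrightarrow> fst (box_op F c) \<subseteq> fst (box_op F d)"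
  by (auto simp: box_op_def Let_def concept_le_iff)

lemma dia_op_mono: "fst c \<subseteq> fst d \<Longrightarrow> fst (dia_op F c) \<subseteq> fst (dia_op F d)"
  unfolding dia_op_def Let_def fst_conv by (rule down_antimono) auto

lemma meaning_Var: "le_model M \<Longrightarrow> meaning M (Var p) = Val M p"
  using conceptD(1,2)[of "Val M p" M] by (auto simp: le_model_def meaning_def intro!: prod_eqI)

lemma meaning_Top: "meaning M Top = (Obj M, up M (Obj M))"
  by (auto simp: meaning_def up_def)

lemma meaning_Bot: "meaning M Bot = (down M (Feat M), Feat M)"
  by (auto simp: meaning_def down_def)

lemma meaning_Conj: "meaning M (Conj \<phi> \<psi>) = concept_meet M (meaning M \<phi>) (meaning M \<psi>)"
  by (auto simp: meaning_def concept_meet_def up_def)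

lemma meaning_Disj: "meaning M (Disj \<phi> \<psi>) = concept_join M (meaning M \<phi>) (meaning M \<psi>)"
  by (auto simp: meaning_def concept_join_def down_def)

lemma meaning_Box: "meaning M (Box \<phi>) = box_op M (meaning M \<phi>)"
  by (auto simp: meaning_def box_op_def Let_def up_def)

lemma meaning_Dia: "meaning M (Dia \<phi>) = dia_op M (meaning M \<phi>)"
  by (auto simp: meaning_def dia_op_def Let_def down_def)

lemma meaning_concept:
  assumes "le_model M"
  shows "meaning M \<phi> \<in> concepts M"
proof (induction \<phi>)
  case (Var p)
  then show ?case using assms by (simp add: meaning_Var) (simp add: le_model_def)
next
  case Bot
  show ?case unfolding meaning_Bot
    by (rule intent_concept) (use up_down_ext[of "Feat M" M] in \<open>auto simp: stable_Feat_def up_def\<close>)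
next
  case Top
  show ?case unfolding meaning_Top
    by (rule extent_concept) (use down_up_ext[of "Obj M" M] in \<open>auto simp: stable_Obj_def down_def\<close>)
qed (use assms in \<open>simp_all add: le_model_def meaning_Conj meaning_Disj meaning_Box meaning_Dia
      concept_meet_closed concept_join_closed box_op_closed dia_op_closed\<close>)

lemma Top_in_filter:
  assumes "le_model M" "F \<in> filters M"
  shows "meaning M Top \<in> F"
proof -
  obtain c where c: "c \<in> F" "c \<in> concepts M" using assms(2) unfolding filters_iff by blast
  have "fst c \<subseteq> fst (meaning M Top)" using conceptD(1)[OF c(2)] by (simp add: meaning_Top)
  then show ?thesis using filter_mono[OF assms(2) c(1)] meaning_concept[OF assms(1)] by blast
qed

lemma Bot_in_ideal:
  assumes "le_model M" "J \<in> ideals M"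
  shows "meaning M Bot \<in> J"
proof -
  obtain c where c: "c \<in> J" "c \<in> concepts M" using assms(2) unfolding ideals_iff by blast
  have "fst (meaning M Bot) \<subseteq> fst c"
    using c meaning_concept[OF assms(1), of Bot] conceptD(2)[OF c(2)]
    by (simp add: concept_le_iff) (simp add: meaning_Bot)
  then show ?thesis using ideal_mono[OF assms(2) c(1)] meaning_concept[OF assms(1)] by blast
qed

section \<open>Truth in the filter-ideal extension\<close>

lemma FI_ext_simps [simp]:
  "Obj (FI_ext M) = filters M"
  "Feat (FI_ext M) = ideals M"
  "(F, J) \<in> Inc (FI_ext M) \<longleftrightarrow> F \<in> filters M \<and> J \<in> ideals M \<and> F \<inter> J \<noteq> {}"
  "(F, J) \<in> RBox (FI_ext M) \<longleftrightarrow> F \<in> filters M \<and> J \<in> ideals M \<and> (\<exists>c\<in>J. box_op M c \<in> F)"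
  "(J, F) \<in> RDia (FI_ext M) \<longleftrightarrow> F \<in> filters M \<and> J \<in> ideals M \<and> (\<exists>c\<in>F. dia_op M c \<in> J)"
  "Val (FI_ext M) p = ({F \<in> filters M. Val M p \<in> F}, {J \<in> ideals M. Val M p \<in> J})"
  by (auto simp: FI_ext_def Let_def)

text \<open>Membership of a concept in a filter is determined by the incidence of the filter with the
  ideals that contain the concept, since one of them is the principal ideal of that concept. This is what makes the
  satisfaction clauses defined through the opposite sort agree with membership.\<close>

lemma in_filter_iff_meets_ideals:
  assumes "F \<in> filters P" "c \<in> concepts P"
  shows "c \<in> F \<longleftrightarrow> (\<forall>J\<in>ideals P. c \<in> J \<longrightarrow> F \<inter> J \<noteq> {})"
proof
  assume "\<forall>J\<in>ideals P. c \<in> J \<longrightarrow> F \<inter> J \<noteq> {}"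
  moreover have "c \<in> principal_ideal (concept_lattice P) c"
    using assms(2) by (simp add: principal_ideal_def)
  ultimately have "F \<inter> principal_ideal (concept_lattice P) c \<noteq> {}"
    using principal_ideal_ideal[OF assms(2)] by blast
  then show "c \<in> F" using filter_mono[OF assms(1) _ assms(2)] by (auto simp: principal_ideal_def)
qed auto

lemma in_ideal_iff_meets_filters:
  assumes "J \<in> ideals P" "c \<in> concepts P"
  shows "c \<in> J \<longleftrightarrow> (\<forall>F\<in>filters P. c \<in> F \<longrightarrow> F \<inter> J \<noteq> {})"
proof
  assume "\<forall>F\<in>filters P. c \<in> F \<longrightarrow> F \<inter> J \<noteq> {}"
  moreover have "c \<in> principal_filter (concept_lattice P) c"
    using assms(2) by (simp add: principal_filter_def)
  ultimately have "principal_filter (concept_lattice P) c \<inter> J \<noteq> {}"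
    using principal_filter_filter[OF assms(2)] by blast
  then show "c \<in> J" using ideal_mono[OF assms(1) _ assms(2)] by (auto simp: principal_filter_def)
qed auto

text \<open>As the operators are monotone, the principal ideal (or filter) of \<open>c\<close> again decides the quantifier
  over the opposite sort.\<close>

lemma box_in_filter_iff:
  assumes "le_frame P" "F \<in> filters P" "c \<in> concepts P"
  shows "box_op P c \<in> F \<longleftrightarrow> (\<forall>J\<in>ideals P. c \<in> J \<longrightarrow> (\<exists>d\<in>J. box_op P d \<in> F))"
proof
  assume "\<forall>J\<in>ideals P. c \<in> J \<longrightarrow> (\<exists>d\<in>J. box_op P d \<in> F)"
  then obtain d where "d \<in> principal_ideal (concept_lattice P) c" "box_op P d \<in> F"
    using principal_ideal_ideal[OF assms(3)] assms(3) by (fastforce simp: principal_ideal_def)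
  then show "box_op P c \<in> F"
    using filter_mono[OF assms(2) _ box_op_closed[OF assms(1,3)]] box_op_mono[OF _ assms(3)]
    by (auto simp: principal_ideal_def)
qed auto

lemma dia_in_ideal_iff:
  assumes "le_frame P" "J \<in> ideals P" "c \<in> concepts P"
  shows "dia_op P c \<in> J \<longleftrightarrow> (\<forall>F\<in>filters P. c \<in> F \<longrightarrow> (\<exists>d\<in>F. dia_op P d \<in> J))"
proof
  assume "\<forall>F\<in>filters P. c \<in> F \<longrightarrow> (\<exists>d\<in>F. dia_op P d \<in> J)"
  then obtain d where "d \<in> principal_filter (concept_lattice P) c" "dia_op P d \<in> J"
    using principal_filter_filter[OF assms(3)] assms(3) by (fastforce simp: principal_filter_def)
  then show "dia_op P c \<in> J"
    using ideal_mono[OF assms(2) _ dia_op_closed[OF assms(1,3)]] dia_op_mono[of c d P]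
    by (auto simp: principal_filter_def)
qed auto

theorem FI_ext_truth:
  assumes M: "le_model M"
  shows "(\<forall>F\<in>filters M. sat (FI_ext M) F \<phi> \<longleftrightarrow> meaning M \<phi> \<in> F) \<and>
         (\<forall>J\<in>ideals M. cosat (FI_ext M) J \<phi> \<longleftrightarrow> meaning M \<phi> \<in> J)"
proof -
  have fr: "le_frame M" using M by (simp add: le_model_def)
  note mc = meaning_concept[OF M]
  show ?thesis
  proof (induction \<phi>)
    case (Var p)
    then show ?case by (simp add: meaning_Var[OF M])
  next
    case Bot
    then show ?case
      using Bot_in_ideal[OF M] by (auto simp: in_filter_iff_meets_ideals[OF _ mc])
  next
    case Top
    then show ?case
      using Top_in_filter[OF M] by (auto simp: in_ideal_iff_meets_filters[OF _ mc])
  next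
    case (Conj \<phi> \<psi>)
    then have "sat (FI_ext M) F (Conj \<phi> \<psi>) \<longleftrightarrow> meaning M (Conj \<phi> \<psi>) \<in> F" if "F \<in> filters M" for F
      using that by (simp add: meaning_Conj filter_meet_iff mc)
    then show ?case
      by (auto simp: in_ideal_iff_meets_filters[OF _ mc] simp del: sat.simps)
  next
    case (Disj \<phi> \<psi>)
    then have "cosat (FI_ext M) J (Disj \<phi> \<psi>) \<longleftrightarrow> meaning M (Disj \<phi> \<psi>) \<in> J" if "J \<in> ideals M" for J
      using that by (simp add: meaning_Disj ideal_join_iff mc)
    then show ?case
      by (auto simp: in_filter_iff_meets_ideals[OF _ mc] simp del: cosat.simps)
  next
    case (Box \<phi>)
    then have "sat (FI_ext M) F (Box \<phi>) \<longleftrightarrow> meaning M (Box \<phi>) \<in> F" if "F \<in> filters M" for F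
      using that by (simp add: meaning_Box box_in_filter_iff[OF fr _ mc])
    then show ?case
      by (auto simp: in_ideal_iff_meets_filters[OF _ mc] simp del: sat.simps)
  next
    case (Dia \<phi>)
    then have "cosat (FI_ext M) J (Dia \<phi>) \<longleftrightarrow> meaning M (Dia \<phi>) \<in> J" if "J \<in> ideals M" for J
      using that by (simp add: meaning_Dia dia_in_ideal_iff[OF fr _ mc])
    then show ?case
      by (auto simp: in_filter_iff_meets_ideals[OF _ mc] simp del: cosat.simps)
  qed
qed

lemmas sat_FI_ext = FI_ext_truth[THEN conjunct1, rule_format]
  and cosat_FI_ext = FI_ext_truth[THEN conjunct2, rule_format]

lemma obj_concept_concept: "a \<in> Obj P \<Longrightarrow> obj_concept P a \<in> concepts P"
  unfolding obj_concept_def by (intro intent_concept stable_Feat_up) auto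

lemma feat_concept_concept: "x \<in> Feat P \<Longrightarrow> feat_concept P x \<in> concepts P"
  unfolding feat_concept_def by (intro extent_concept stable_Obj_down) auto

lemma Fi_filter: "a \<in> Obj P \<Longrightarrow> Fi P a \<in> filters P"
  unfolding Fi_def by (intro principal_filter_filter obj_concept_concept)

lemma Idl_ideal: "x \<in> Feat P \<Longrightarrow> Idl P x \<in> ideals P"
  unfolding Idl_def by (intro principal_ideal_ideal feat_concept_concept)

lemma in_Fi_iff:
  assumes "a \<in> Obj P" "c \<in> concepts P"
  shows "c \<in> Fi P a \<longleftrightarrow> a \<in> fst c"
proof -
  have "fst (obj_concept P a) \<subseteq> fst c \<longleftrightarrow> snd c \<subseteq> up P {a}"
    using concept_le_iff[OF obj_concept_concept[OF assms(1)] assms(2)] by (simp add: obj_concept_def)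
  also have "\<dots> \<longleftrightarrow> a \<in> down P (snd c)"
    using assms(1) conceptD(2)[OF assms(2)] by (auto simp: up_def down_def)
  finally show ?thesis using assms by (simp add: Fi_def principal_filter_def conceptD(4))
qed

lemma in_Idl_iff:
  assumes "x \<in> Feat P" "c \<in> concepts P"
  shows "c \<in> Idl P x \<longleftrightarrow> x \<in> snd c"
proof -
  have "fst c \<subseteq> fst (feat_concept P x) \<longleftrightarrow> x \<in> up P (fst c)"
    using assms(1) conceptD(1)[OF assms(2)] by (auto simp: up_def down_def feat_concept_def)
  then show ?thesis using assms by (simp add: Idl_def principal_ideal_def conceptD(3))
qed

lemma sat_Fi:
  "le_model M \<Longrightarrow> a \<in> Obj M \<Longrightarrow> sat (FI_ext M) (Fi M a) \<phi> \<longleftrightarrow> sat M a \<phi>"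
  by (simp add: sat_FI_ext Fi_filter in_Fi_iff meaning_concept) (simp add: meaning_def)

lemma cosat_Idl:
  "le_model M \<Longrightarrow> x \<in> Feat M \<Longrightarrow> cosat (FI_ext M) (Idl M x) \<phi> \<longleftrightarrow> cosat M x \<phi>"
  by (simp add: cosat_FI_ext Idl_ideal in_Idl_iff meaning_concept) (simp add: meaning_def)

section \<open>Simulations and modal equivalence\<close>

text \<open>The two halves need each other: a clause for one sort that quantifies over the other sort is
  transferred by contraposition, a failure on one side being matched by a failure on the other.\<close>

lemma simulation_preserves:
  assumes sim: "simulation M1 M2 S T"
  shows "(\<forall>a1 a2. (a1, a2) \<in> S \<longrightarrow> sat M1 a1 \<phi> \<longrightarrow> sat M2 a2 \<phi>) \<and>
         (\<forall>x1 x2. (x1, x2) \<in> T \<longrightarrow> cosat M2 x2 \<phi> \<longrightarrow> cosat M1 x1 \<phi>)"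
proof -
  have S3: "\<And>a1 a2 x2. (a1, a2) \<in> S \<Longrightarrow> x2 \<in> Feat M2 \<Longrightarrow> (a2, x2) \<notin> Inc M2 \<Longrightarrow>
      \<exists>x1\<in>Feat M1. (a1, x1) \<notin> Inc M1 \<and> (x1, x2) \<in> T"
    and S4: "\<And>x1 x2 a1. (x1, x2) \<in> T \<Longrightarrow> a1 \<in> Obj M1 \<Longrightarrow> (a1, x1) \<notin> Inc M1 \<Longrightarrow>
      \<exists>a2\<in>Obj M2. (a2, x2) \<notin> Inc M2 \<and> (a1, a2) \<in> S"
    and S5: "\<And>a1 a2 x2. (a1, a2) \<in> S \<Longrightarrow> x2 \<in> Feat M2 \<Longrightarrow> (a2, x2) \<notin> RBox M2 \<Longrightarrow>
      \<exists>x1\<in>Feat M1. (a1, x1) \<notin> RBox M1 \<and> (x1, x2) \<in> T"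
    and S6: "\<And>x1 x2 a1. (x1, x2) \<in> T \<Longrightarrow> a1 \<in> Obj M1 \<Longrightarrow> (x1, a1) \<notin> RDia M1 \<Longrightarrow>
      \<exists>a2\<in>Obj M2. (x2, a2) \<notin> RDia M2 \<and> (a1, a2) \<in> S"
    using sim unfolding simulation_def by metis+
  show ?thesis
  proof (induction \<phi>)
    case (Var p)
    then show ?case using sim by (simp add: simulation_def)
  next
    case Bot
    show ?case using S3 by fastforce
  next
    case Top
    show ?case using S4 by fastforce
  next
    case (Conj \<phi> \<psi>)
    then have "\<forall>a1 a2. (a1, a2) \<in> S \<longrightarrow> sat M1 a1 (Conj \<phi> \<psi>) \<longrightarrow> sat M2 a2 (Conj \<phi> \<psi>)" by auto
    then show ?case unfolding cosat.simps using S4 by meson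
  next
    case (Disj \<phi> \<psi>)
    then have "\<forall>x1 x2. (x1, x2) \<in> T \<longrightarrow> cosat M2 x2 (Disj \<phi> \<psi>) \<longrightarrow> cosat M1 x1 (Disj \<phi> \<psi>)" by auto
    then show ?case unfolding sat.simps using S3 by meson
  next
    case (Box \<phi>)
    then have "\<forall>a1 a2. (a1, a2) \<in> S \<longrightarrow> sat M1 a1 (Box \<phi>) \<longrightarrow> sat M2 a2 (Box \<phi>)"
      unfolding sat.simps using S5 by meson
    then show ?case unfolding cosat.simps using S4 by meson
  next
    case (Dia \<phi>)
    then have "\<forall>x1 x2. (x1, x2) \<in> T \<longrightarrow> cosat M2 x2 (Dia \<phi>) \<longrightarrow> cosat M1 x1 (Dia \<phi>)"
      unfolding cosat.simps using S6 by meson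
    then show ?case unfolding sat.simps using S3 by meson
  qed
qed

lemma bisimilar_Obj_modal_equiv: "bisimilar_Obj M1 a1 M2 a2 \<Longrightarrow> modal_equiv_Obj M1 a1 M2 a2"
  unfolding bisimilar_Obj_def modal_equiv_Obj_def using simulation_preserves by metis

lemma bisimilar_Feat_modal_equiv: "bisimilar_Feat M1 x1 M2 x2 \<Longrightarrow> modal_equiv_Feat M1 x1 M2 x2"
  unfolding bisimilar_Feat_def modal_equiv_Feat_def using simulation_preserves by metis

definition filter_incl ::
  "('a, 'x, 'v, 'm) model_scheme \<Rightarrow> ('b, 'y, 'v, 'n) model_scheme \<Rightarrow>
   (('a, 'x) concept set \<times> ('b, 'y) concept set) set" where
  "filter_incl M1 M2 = {(F1, F2). F1 \<in> filters M1 \<and> F2 \<in> filters M2 \<and>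
     (\<forall>\<phi>. meaning M1 \<phi> \<in> F1 \<longrightarrow> meaning M2 \<phi> \<in> F2)}"

definition ideal_incl ::
  "('a, 'x, 'v, 'm) model_scheme \<Rightarrow> ('b, 'y, 'v, 'n) model_scheme \<Rightarrow>
   (('a, 'x) concept set \<times> ('b, 'y) concept set) set" where
  "ideal_incl M1 M2 = {(J1, J2). J1 \<in> ideals M1 \<and> J2 \<in> ideals M2 \<and>
     (\<forall>\<phi>. meaning M2 \<phi> \<in> J2 \<longrightarrow> meaning M1 \<phi> \<in> J1)}"

text \<open>The filter of \<open>M2\<close> generated by the formulas that hold at the filter \<open>F1\<close> of \<open>M1\<close>; dually below,
  the ideal of \<open>M1\<close> generated by the formulas that hold at the ideal \<open>J2\<close> of \<open>M2\<close>. They are the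
  least points related to \<open>F1\<close> by \<open>filter_incl\<close> and to \<open>J2\<close> by \<open>ideal_incl\<close>. In a filter-ideal extension
  incidence and accessibility grow with the filter and the ideal, and the clauses of a simulation
  demand non-incidence or non-accessibility, so no other choice could do better.\<close>

definition transfer_filter ::
  "('a, 'x, 'v, 'm) model_scheme \<Rightarrow> ('b, 'y, 'v, 'n) model_scheme \<Rightarrow>
   ('a, 'x) concept set \<Rightarrow> ('b, 'y) concept set" where
  "transfer_filter M1 M2 F1 =
     {c \<in> concepts M2. \<exists>\<phi>. meaning M1 \<phi> \<in> F1 \<and> fst (meaning M2 \<phi>) \<subseteq> fst c}"

definition transfer_ideal ::
  "('a, 'x, 'v, 'm) model_scheme \<Rightarrow> ('b, 'y, 'v, 'n) model_scheme \<Rightarrow>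
   ('b, 'y) concept set \<Rightarrow> ('a, 'x) concept set" where
  "transfer_ideal M1 M2 J2 =
     {c \<in> concepts M1. \<exists>\<phi>. meaning M2 \<phi> \<in> J2 \<and> fst c \<subseteq> fst (meaning M1 \<phi>)}"

lemma transfer_filter_incl:
  assumes M: "le_model M1" "le_model M2" and F: "F1 \<in> filters M1"
  shows "(F1, transfer_filter M1 M2 F1) \<in> filter_incl M1 M2"
proof -
  let ?F = "transfer_filter M1 M2 F1"
  note mc = M[THEN meaning_concept]
  have incl: "meaning M2 \<phi> \<in> ?F" if "meaning M1 \<phi> \<in> F1" for \<phi>
    using that mc by (auto simp: transfer_filter_def)
  have "concept_meet M2 c d \<in> ?F" if cd: "c \<in> ?F" "d \<in> ?F" for c d
  proof -
    obtain \<phi> \<psi> where "meaning M1 \<phi> \<in> F1" "fst (meaning M2 \<phi>) \<subseteq> fst c"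
      and "meaning M1 \<psi> \<in> F1" "fst (meaning M2 \<psi>) \<subseteq> fst d"
      using cd by (auto simp: transfer_filter_def)
    then have "meaning M1 (Conj \<phi> \<psi>) \<in> F1"
      and "fst (meaning M2 (Conj \<phi> \<psi>)) \<subseteq> fst (concept_meet M2 c d)"
      unfolding meaning_Conj by (simp_all add: filter_meet_iff F mc concept_meet_mono)
    then show ?thesis using cd concept_meet_closed unfolding transfer_filter_def by blast
  qed
  moreover have "?F \<noteq> {}" using incl[OF Top_in_filter[OF M(1) F]] by auto
  moreover have "?F \<subseteq> concepts M2" unfolding transfer_filter_def by blast
  moreover have "d \<in> ?F" if "c \<in> ?F" "d \<in> concepts M2" "fst c \<subseteq> fst d" for c d
    using that unfolding transfer_filter_def by blast
  ultimately have "?F \<in> filters M2" unfolding filters_iff by blast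
  then show ?thesis using F incl by (simp add: filter_incl_def)
qed

lemma transfer_ideal_incl:
  assumes M: "le_model M1" "le_model M2" and J: "J2 \<in> ideals M2"
  shows "(transfer_ideal M1 M2 J2, J2) \<in> ideal_incl M1 M2"
proof -
  let ?J = "transfer_ideal M1 M2 J2"
  note mc = M[THEN meaning_concept]
  have incl: "meaning M1 \<phi> \<in> ?J" if "meaning M2 \<phi> \<in> J2" for \<phi>
    using that mc by (auto simp: transfer_ideal_def)
  have "concept_join M1 c d \<in> ?J" if cd: "c \<in> ?J" "d \<in> ?J" for c d
  proof -
    have cd': "c \<in> concepts M1" "d \<in> concepts M1" using cd by (auto simp: transfer_ideal_def)
    obtain \<phi> \<psi> where "meaning M2 \<phi> \<in> J2" "fst c \<subseteq> fst (meaning M1 \<phi>)"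
      and "meaning M2 \<psi> \<in> J2" "fst d \<subseteq> fst (meaning M1 \<psi>)"
      using cd by (auto simp: transfer_ideal_def)
    then have "meaning M2 (Disj \<phi> \<psi>) \<in> J2"
      and "fst (concept_join M1 c d) \<subseteq> fst (meaning M1 (Disj \<phi> \<psi>))"
      unfolding meaning_Disj by (simp_all add: ideal_join_iff J mc cd' concept_join_mono)
    then show ?thesis using concept_join_closed[OF cd'] unfolding transfer_ideal_def by blast
  qed
  moreover have "?J \<noteq> {}" using incl[OF Bot_in_ideal[OF M(2) J]] by auto
  moreover have "?J \<subseteq> concepts M1" unfolding transfer_ideal_def by blast
  moreover have "d \<in> ?J" if "c \<in> ?J" "d \<in> concepts M1" "fst d \<subseteq> fst c" for c d
    using that unfolding transfer_ideal_def by blast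
  ultimately have "?J \<in> ideals M1" unfolding ideals_iff by blast
  then show ?thesis using J incl by (simp add: ideal_incl_def)
qed

text \<open>A relation between a point and a generated filter or ideal is always witnessed by the meaning of
  a formula; the witness then relates the points of the other model.\<close>

lemma inclusion_simulation:
  assumes M: "le_model M1" "le_model M2"
  shows "simulation (FI_ext M1) (FI_ext M2) (filter_incl M1 M2) (ideal_incl M1 M2)"
proof -
  note mc = M[THEN meaning_concept]
  have fr: "le_frame M1" "le_frame M2" using M by (auto simp: le_model_def)
  have inc: "F2 \<inter> J2 \<noteq> {}"
    if asm: "(F1, F2) \<in> filter_incl M1 M2" "F1 \<inter> transfer_ideal M1 M2 J2 \<noteq> {}" for F1 F2 J2
  proof -
    obtain c \<phi> where "c \<in> F1" "meaning M2 \<phi> \<in> J2" "fst c \<subseteq> fst (meaning M1 \<phi>)"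
      using asm(2) by (auto simp: transfer_ideal_def)
    then show ?thesis using asm(1) filter_mono[OF _ _ mc(1)] unfolding filter_incl_def by blast
  qed
  have inc': "F1 \<inter> J1 \<noteq> {}"
    if asm: "(J1, J2) \<in> ideal_incl M1 M2" "transfer_filter M1 M2 F1 \<inter> J2 \<noteq> {}" for J1 J2 F1
  proof -
    obtain c \<phi> where "c \<in> J2" "meaning M1 \<phi> \<in> F1" "fst (meaning M2 \<phi>) \<subseteq> fst c"
      using asm(2) by (auto simp: transfer_filter_def)
    then show ?thesis using asm(1) ideal_mono[OF _ _ mc(2)] unfolding ideal_incl_def by blast
  qed
  have box: "\<exists>d\<in>J2. box_op M2 d \<in> F2"
    if asm: "(F1, F2) \<in> filter_incl M1 M2" "c \<in> transfer_ideal M1 M2 J2" "box_op M1 c \<in> F1" for F1 F2 J2 c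
  proof -
    obtain \<phi> where \<phi>: "c \<in> concepts M1" "meaning M2 \<phi> \<in> J2" "fst c \<subseteq> fst (meaning M1 \<phi>)"
      using asm(2) by (auto simp: transfer_ideal_def)
    have "meaning M1 (Box \<phi>) \<in> F1"
      unfolding meaning_Box using asm \<phi> filter_mono[OF _ asm(3) box_op_closed[OF fr(1) mc(1)]]
        box_op_mono[OF \<phi>(1) mc(1) \<phi>(3)]
      by (auto simp: filter_incl_def)
    then have "meaning M2 (Box \<phi>) \<in> F2" using asm(1) by (simp add: filter_incl_def)
    then show ?thesis using \<phi>(2) by (auto simp: meaning_Box)
  qed
  have dia: "\<exists>d\<in>F1. dia_op M1 d \<in> J1"
    if asm: "(J1, J2) \<in> ideal_incl M1 M2" "c \<in> transfer_filter M1 M2 F1" "dia_op M2 c \<in> J2" for J1 J2 F1 c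
  proof -
    obtain \<phi> where \<phi>: "meaning M1 \<phi> \<in> F1" "fst (meaning M2 \<phi>) \<subseteq> fst c"
      using asm(2) by (auto simp: transfer_filter_def)
    have "meaning M2 (Dia \<phi>) \<in> J2"
      unfolding meaning_Dia using asm ideal_mono[OF _ asm(3) dia_op_closed[OF fr(2) mc(2)]]
        dia_op_mono[OF \<phi>(2)]
      by (auto simp: ideal_incl_def)
    then have "meaning M1 (Dia \<phi>) \<in> J1" using asm(1) by (simp add: ideal_incl_def)
    then show ?thesis using \<phi>(1) by (auto simp: meaning_Dia)
  qed
  have valuation: "\<And>F1 F2 p. (F1, F2) \<in> filter_incl M1 M2 \<Longrightarrow> Val M1 p \<in> F1 \<Longrightarrow> Val M2 p \<in> F2"
    "\<And>J1 J2 p. (J1, J2) \<in> ideal_incl M1 M2 \<Longrightarrow> Val M2 p \<in> J2 \<Longrightarrow> Val M1 p \<in> J1"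
    using M by (auto simp: filter_incl_def ideal_incl_def meaning_Var[symmetric])
  have sub: "(F1, F2) \<in> filter_incl M1 M2 \<Longrightarrow> F1 \<in> filters M1 \<and> F2 \<in> filters M2"
    "(J1, J2) \<in> ideal_incl M1 M2 \<Longrightarrow> J1 \<in> ideals M1 \<and> J2 \<in> ideals M2" for F1 F2 J1 J2
    by (auto simp: filter_incl_def ideal_incl_def)
  note tf = transfer_filter_incl[OF M] and ti = transfer_ideal_incl[OF M]
  show ?thesis
    unfolding simulation_def
  proof (intro conjI allI ballI impI; (elim conjE)?)
    fix F1 F2 J2
    assume F: "(F1, F2) \<in> filter_incl M1 M2" and J: "J2 \<in> Feat (FI_ext M2)"
    show "\<exists>J1\<in>Feat (FI_ext M1). (F1, J1) \<notin> Inc (FI_ext M1) \<and> (J1, J2) \<in> ideal_incl M1 M2"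
      if "(F2, J2) \<notin> Inc (FI_ext M2)"
      using that F J sub(1)[OF F] sub(2)[OF ti] inc[OF F] ti
      unfolding FI_ext_simps by blast
    show "\<exists>J1\<in>Feat (FI_ext M1). (F1, J1) \<notin> RBox (FI_ext M1) \<and> (J1, J2) \<in> ideal_incl M1 M2"
      if "(F2, J2) \<notin> RBox (FI_ext M2)"
      using that F J sub(1)[OF F] sub(2)[OF ti] box[OF F] ti
      unfolding FI_ext_simps by blast
  next
    fix J1 J2 F1
    assume J: "(J1, J2) \<in> ideal_incl M1 M2" and F: "F1 \<in> Obj (FI_ext M1)"
    show "\<exists>F2\<in>Obj (FI_ext M2). (F2, J2) \<notin> Inc (FI_ext M2) \<and> (F1, F2) \<in> filter_incl M1 M2"
      if "(F1, J1) \<notin> Inc (FI_ext M1)"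
      using that F J sub(2)[OF J] sub(1)[OF tf] inc'[OF J] tf
      unfolding FI_ext_simps by blast
    show "\<exists>F2\<in>Obj (FI_ext M2). (J2, F2) \<notin> RDia (FI_ext M2) \<and> (F1, F2) \<in> filter_incl M1 M2"
      if "(J1, F1) \<notin> RDia (FI_ext M1)"
      using that F J sub(2)[OF J] sub(1)[OF tf] dia[OF J] tf
      unfolding FI_ext_simps by blast
  qed (use sub valuation in auto)
qed

lemma FI_ext_modal_equiv_Obj_bisimilar:
  assumes "le_model M1" "le_model M2" "F1 \<in> filters M1" "F2 \<in> filters M2"
    and "modal_equiv_Obj (FI_ext M1) F1 (FI_ext M2) F2"
  shows "bisimilar_Obj (FI_ext M1) F1 (FI_ext M2) F2"
proof -
  have "(F1, F2) \<in> filter_incl M1 M2" "(F2, F1) \<in> filter_incl M2 M1"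
    using assms by (auto simp: filter_incl_def modal_equiv_Obj_def sat_FI_ext)
  then show ?thesis
    using inclusion_simulation[OF assms(1,2)] inclusion_simulation[OF assms(2,1)]
    unfolding bisimilar_Obj_def by blast
qed

lemma FI_ext_modal_equiv_Feat_bisimilar:
  assumes "le_model M1" "le_model M2" "J1 \<in> ideals M1" "J2 \<in> ideals M2"
    and "modal_equiv_Feat (FI_ext M1) J1 (FI_ext M2) J2"
  shows "bisimilar_Feat (FI_ext M1) J1 (FI_ext M2) J2"
proof -
  have "(J1, J2) \<in> ideal_incl M1 M2" "(J2, J1) \<in> ideal_incl M2 M1"
    using assms by (auto simp: ideal_incl_def modal_equiv_Feat_def cosat_FI_ext)
  then show ?thesis
    using inclusion_simulation[OF assms(1,2)] inclusion_simulation[OF assms(2,1)]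
    unfolding bisimilar_Feat_def by blast
qed

theorem corollary4p10:
  fixes M1 :: "('a1, 'x1, 'v::countable) model"
    and M2 :: "('a2, 'x2, 'v) model"
    and a1 :: 'a1 and x1 :: 'x1 and a2 :: 'a2 and x2 :: 'x2
  assumes "le_model M1" and "le_model M2"
    and "a1 \<in> Obj M1" and "x1 \<in> Feat M1" and "a2 \<in> Obj M2" and "x2 \<in> Feat M2"
  shows "(modal_equiv_Obj M1 a1 M2 a2 \<longleftrightarrow>
            bisimilar_Obj (FI_ext M1) (Fi M1 a1) (FI_ext M2) (Fi M2 a2)) \<and>
         (modal_equiv_Feat M1 x1 M2 x2 \<longleftrightarrow>
            bisimilar_Feat (FI_ext M1) (Idl M1 x1) (FI_ext M2) (Idl M2 x2))"
proof -
  have "modal_equiv_Obj M1 a1 M2 a2 \<longleftrightarrow>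
      modal_equiv_Obj (FI_ext M1) (Fi M1 a1) (FI_ext M2) (Fi M2 a2)"
    using assms by (simp add: modal_equiv_Obj_def sat_Fi)
  moreover have "modal_equiv_Feat M1 x1 M2 x2 \<longleftrightarrow>
      modal_equiv_Feat (FI_ext M1) (Idl M1 x1) (FI_ext M2) (Idl M2 x2)"
    using assms by (simp add: modal_equiv_Feat_def cosat_Idl)
  moreover have "modal_equiv_Obj (FI_ext M1) (Fi M1 a1) (FI_ext M2) (Fi M2 a2) \<longleftrightarrow>
      bisimilar_Obj (FI_ext M1) (Fi M1 a1) (FI_ext M2) (Fi M2 a2)"
    by (rule iffI[OF FI_ext_modal_equiv_Obj_bisimilar[OF assms(1,2)] bisimilar_Obj_modal_equiv])
      (simp_all add: assms Fi_filter)
  moreover have "modal_equiv_Feat (FI_ext M1) (Idl M1 x1) (FI_ext M2) (Idl M2 x2) \<longleftrightarrow>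
      bisimilar_Feat (FI_ext M1) (Idl M1 x1) (FI_ext M2) (Idl M2 x2)"
    by (rule iffI[OF FI_ext_modal_equiv_Feat_bisimilar[OF assms(1,2)] bisimilar_Feat_modal_equiv])
      (simp_all add: assms Idl_ideal)
  ultimately show ?thesis by blast
qed

end
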